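(* Let $n\ge 1$ be an integer. For every integer $k \geq n$, $\operatorname{St}_{\operatorname{orth}}(n,\mathbb{C}^k)$ is connected. In particular, the unitary group $U(n)$ is connected.
   Context: $\operatorname{St}_{\operatorname{orth}}(n,\mathbb{C}^k) = \{(v_1,\ldots,v_n)\in (\mathbb{C}^k)^n : \langle v_i,v_j\rangle = \delta_{ij} \text{ for all } i,j\}$, where $\langle\cdot,\cdot\rangle$ is the standard Hermitian inner product, with the subspace topology from $(\mathbb{C}^k)^n$. *)

theory Defs
  imports "HOL-Analysis.Analysis"
begin

definition hermitian_inner :: "complex ^ 'k \<Rightarrow> complex ^ 'k \<Rightarrow> complex" where
  "hermitian_inner x y = (\<Sum>i\<in>UNIV. x $ i * cnj (y $ i))"

text \<open>An \<open>n\<close>-tuple \<open>v\<close> of vectors in \<open>k\<close>-dimensional complex space is an element of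
  \<^typ>\<open>(complex ^ 'k) ^ 'n\<close>, with members \<open>v $ i\<close>. This type carries the product topology, and
  the library's \<^const>\<open>connected\<close> on a set refers to the subspace topology.\<close>

definition St_orth :: "((complex ^ 'k) ^ 'n) set" where
  "St_orth = {v. \<forall>i j. hermitian_inner (v $ i) (v $ j) = (if i = j then 1 else 0)}"

definition conj_transpose :: "complex ^ 'n ^ 'm \<Rightarrow> complex ^ 'm ^ 'n" where
  "conj_transpose A = (\<chi> i j. cnj (A $ j $ i))"

definition unitary_group :: "(complex ^ 'n ^ 'n) set" where
  "unitary_group = {A. conj_transpose A ** A = mat 1 \<and> A ** conj_transpose A = mat 1}"

end

theory Submission imports Defs begin

text \<open>Frames are built one vector at a time. Forgetting the last vector of a frame is a continuous
  surjection of compact spaces, and its fibre is the unit sphere of a nonzero complex subspace. Such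
  a sphere is connected because a real subspace of dimension other than one stays connected when
  the origin is removed. A continuous closed surjection with connected fibres pulls connected sets
  back to connected sets, so induction gives the claim. Finally, a square matrix is unitary as soon
  as its rows are orthonormal.\<close>

lemma hermitian_inner_add_left:
  "hermitian_inner (x + y) z = hermitian_inner x z + hermitian_inner y z"
  by (simp add: hermitian_inner_def algebra_simps sum.distrib)

lemma hermitian_inner_scaleR_left:
  "hermitian_inner (c *\<^sub>R x) z = of_real c * hermitian_inner x z"
  by (simp only: hermitian_inner_def vector_scaleR_component scaleR_conv_of_real[of c "_ :: complex"]
      sum_distrib_left mult.assoc)

lemma hermitian_inner_mult_left:
  "hermitian_inner (c *s x) z = c * hermitian_inner x z"
  by (simp add: hermitian_inner_def sum_distrib_left mult.assoc)

lemma hermitian_inner_mult_right: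
  "hermitian_inner x (c *s z) = cnj c * hermitian_inner x z"
  by (simp add: hermitian_inner_def sum_distrib_left mult_ac)

lemma hermitian_inner_zero_left [simp]: "hermitian_inner 0 z = 0"
  by (simp add: hermitian_inner_def)

lemma cnj_hermitian_inner: "cnj (hermitian_inner x y) = hermitian_inner y x"
  by (simp add: hermitian_inner_def mult.commute)

lemma hermitian_inner_eq_0_commute: "hermitian_inner x y = 0 \<longleftrightarrow> hermitian_inner y x = 0"
  by (metis cnj_hermitian_inner complex_cnj_zero_iff)

text \<open>This links the Hermitian form to the real inner product that underlies the library's
  \<open>norm\<close>, \<open>orthogonal\<close> and \<open>dim\<close>.\<close>

lemma Re_hermitian_inner: "Re (hermitian_inner x y) = x \<bullet> y"
  by (simp add: hermitian_inner_def inner_vec_def inner_complex_def)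

lemma hermitian_inner_self: "hermitian_inner x x = of_real ((norm x)\<^sup>2)"
proof (rule complex_eqI)
  show "Re (hermitian_inner x x) = Re (of_real ((norm x)\<^sup>2))"
    by (simp add: Re_hermitian_inner dot_square_norm)
  show "Im (hermitian_inner x x) = Im (of_real ((norm x)\<^sup>2))"
    by (simp add: hermitian_inner_def)
qed

lemma hermitian_inner_self_eq_1_iff: "hermitian_inner x x = 1 \<longleftrightarrow> norm x = 1"
proof -
  have "hermitian_inner x x = 1 \<longleftrightarrow> (norm x)\<^sup>2 = 1"
    unfolding hermitian_inner_self by (metis of_real_1 of_real_eq_iff)
  then show ?thesis
    by (simp add: power2_eq_1_iff) (smt (verit) norm_ge_zero)
qed

lemma continuous_on_hermitian_inner [continuous_intros]:
  assumes "continuous_on A f" "continuous_on A g"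
  shows "continuous_on A (\<lambda>x. hermitian_inner (f x) (g x))"
  unfolding hermitian_inner_def by (intro continuous_intros assms)

text \<open>Orthogonality is Hermitian rather than real, which makes this a complex
  subspace.\<close>

definition orth_compl :: "(complex ^ 'k) set \<Rightarrow> (complex ^ 'k) set" where
  "orth_compl B = {u. \<forall>w\<in>B. hermitian_inner u w = 0}"

lemma subspace_orth_compl: "subspace (orth_compl B)"
  by (rule subspaceI)
    (auto simp: orth_compl_def hermitian_inner_add_left hermitian_inner_scaleR_left)

lemma mult_mem_orth_compl: "u \<in> orth_compl B \<Longrightarrow> c *s u \<in> orth_compl B"
  by (simp add: orth_compl_def hermitian_inner_mult_left)

text \<open>Hermitian orthogonality to \<open>w\<close> amounts to real orthogonality to both
  \<open>w\<close> and its multiple by the imaginary unit. So at most \<open>2 * card B\<close> real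
  conditions arise in a space of real dimension \<open>2 * CARD('k)\<close>.\<close>

lemma orth_compl_unit_vector_exists:
  fixes B :: "(complex ^ 'k) set"
  assumes "finite B" "card B < CARD('k)"
  obtains u where "u \<in> orth_compl B" "norm u = 1"
proof -
  let ?C = "B \<union> (\<lambda>w. \<i> *s w) ` B"
  have "dim ?C \<le> card ?C"
    using assms(1) by (intro dim_le_card') auto
  also have "\<dots> \<le> card B + card B"
    by (meson assms(1) add_left_mono card_Un_le card_image_le order_trans)
  also have "\<dots> < DIM(complex ^ 'k)"
    using assms(2) by simp
  finally obtain x where "x \<noteq> 0" and x: "\<And>y. y \<in> span ?C \<Longrightarrow> orthogonal x y"
    using orthogonal_to_subspace_exists by blast
  have "hermitian_inner x w = 0" if "w \<in> B" for w
  proof (rule complex_eqI)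
    show "Re (hermitian_inner x w) = Re 0"
      using x[of w] that by (simp add: span_base orthogonal_def Re_hermitian_inner)
    have "x \<bullet> (\<i> *s w) = 0"
      using x[of "\<i> *s w"] that by (simp add: span_base orthogonal_def)
    \<comment> \<open>The second argument is conjugate-linear, so the imaginary unit comes out as
      its negative, which moves the imaginary part into the real part.\<close>
    then show "Im (hermitian_inner x w) = Im 0"
      by (simp flip: Re_hermitian_inner add: hermitian_inner_mult_right)
  qed
  then have "x /\<^sub>R norm x \<in> orth_compl B"
    by (simp add: orth_compl_def hermitian_inner_scaleR_left)
  with \<open>x \<noteq> 0\<close> show thesis
    by (intro that) auto
qed

text \<open>On a real line mapped to itself, multiplication by the imaginary unit would act as a
  real scalar.\<close>

lemma aff_dim_complex_subspace_ne_1: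
  fixes W :: "(complex ^ 'k) set"
  assumes "subspace W" and imult: "\<And>u. u \<in> W \<Longrightarrow> \<i> *s u \<in> W"
  shows "aff_dim W \<noteq> 1"
proof
  assume "aff_dim W = 1"
  then have "dim W = 1"
    using aff_dim_subspace[OF assms(1)] by simp
  then obtain B where B: "B \<subseteq> W" "independent B" "W \<subseteq> span B" "card B = 1"
    by (metis basis_exists)
  then obtain b where b: "B = {b}"
    by (meson card_1_singletonE)
  then have "b \<noteq> 0"
    using B(2) by (auto simp: dependent_zero)
  then obtain j where j: "b $ j \<noteq> 0"
    by (metis vec_eq_iff zero_index)
  have "\<i> *s b \<in> span {b}"
    using imult B b by auto
  then obtain c where "\<i> *s b = c *\<^sub>R b"
    by (auto simp: span_singleton)
  then have "\<i> * b $ j = of_real c * b $ j"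
    by (metis scaleR_conv_of_real vector_scaleR_component vector_smult_component)
  then have "\<i> = of_real c"
    using j by simp
  then show False
    by (metis Im_complex_of_real imaginary_unit.simps(2) zero_neq_one)
qed

text \<open>Normalisation maps the punctured subspace continuously onto its unit sphere. In
  dimension one that sphere would be two points.\<close>

lemma connected_subspace_Int_sphere:
  fixes W :: "'a::euclidean_space set"
  assumes "subspace W" "aff_dim W \<noteq> 1"
  shows "connected (W \<inter> sphere 0 1)"
proof -
  have "W \<inter> sphere 0 1 = (\<lambda>x. x /\<^sub>R norm x) ` (W - {0})"
  proof
    show "W \<inter> sphere 0 1 \<subseteq> (\<lambda>x. x /\<^sub>R norm x) ` (W - {0})"
      by (force simp: image_iff)
    show "(\<lambda>x. x /\<^sub>R norm x) ` (W - {0}) \<subseteq> W \<inter> sphere 0 1"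
    proof
      fix z
      assume "z \<in> (\<lambda>x. x /\<^sub>R norm x) ` (W - {0})"
      then obtain x where "x \<in> W" "x \<noteq> 0" "z = x /\<^sub>R norm x"
        by blast
      then show "z \<in> W \<inter> sphere 0 1"
        using assms(1) by (simp add: subspace_scale)
    qed
  qed
  moreover have "connected (W - {0})"
    using assms by (intro connected_punctured_convex subspace_imp_convex)
  ultimately show ?thesis
    by (auto intro!: connected_continuous_image continuous_intros)
qed

definition frames :: "'n set \<Rightarrow> ((complex ^ 'k) ^ 'n) set" where
  "frames S = {v. (\<forall>i\<in>S. \<forall>j\<in>S. hermitian_inner (v $ i) (v $ j) = (if i = j then 1 else 0))
    \<and> (\<forall>i\<in>-S. v $ i = 0)}"

lemma norm_frame_le_1:
  assumes "v \<in> frames S"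
  shows "norm (v $ i) \<le> 1"
proof (cases "i \<in> S")
  case True
  then have "hermitian_inner (v $ i) (v $ i) = 1"
    using assms by (simp add: frames_def)
  then show ?thesis
    by (simp add: hermitian_inner_self_eq_1_iff)
qed (use assms in \<open>simp add: frames_def\<close>)

lemma compact_frames: "compact (frames S :: ((complex ^ 'k) ^ 'n) set)"
proof -
  have "closed (frames S :: ((complex ^ 'k) ^ 'n) set)"
    unfolding frames_def Ball_def
    by (intro closed_Collect_conj closed_Collect_all closed_Collect_imp closed_Collect_eq
        continuous_intros open_Collect_const)
  moreover have "norm v \<le> real CARD('n)" if "v \<in> frames S" for v :: "(complex ^ 'k) ^ 'n"
  proof -
    have "norm v \<le> (\<Sum>i\<in>UNIV. norm (v $ i))"
      unfolding norm_vec_def by (rule L2_set_le_sum) simp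
    also have "\<dots> \<le> (\<Sum>i\<in>(UNIV :: 'n set). 1)"
      by (intro sum_mono norm_frame_le_1[OF that])
    finally show ?thesis
      by simp
  qed
  ultimately show ?thesis
    by (auto simp: compact_eq_bounded_closed bounded_iff)
qed

text \<open>One operation serves both directions: \<open>u = 0\<close> forgets the member at
  \<open>a\<close>, and a suitable unit vector \<open>u\<close> extends a partial frame.\<close>

definition set_member :: "'n \<Rightarrow> 'b \<Rightarrow> 'b ^ 'n \<Rightarrow> 'b ^ 'n" where
  "set_member a u v = (\<chi> i. if i = a then u else v $ i)"

lemma set_member_nth [simp]: "set_member a u v $ i = (if i = a then u else v $ i)"
  by (simp add: set_member_def)

lemma continuous_on_set_member [continuous_intros]:
  assumes "continuous_on A f" "continuous_on A g"
  shows "continuous_on A (\<lambda>x. set_member a (f x) (g x))"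
proof -
  have "continuous_on A (\<lambda>x. if i = a then f x else g x $ i)" for i
    using assms by (cases "i = a") (auto intro!: continuous_intros)
  then show ?thesis
    unfolding set_member_def by (intro continuous_intros)
qed

lemma set_member_mem_frames_iff:
  assumes "y \<in> frames S" "a \<notin> S"
  shows "set_member a u y \<in> frames (insert a S) \<longleftrightarrow>
    u \<in> orth_compl (($) y ` S) \<inter> sphere 0 1"
proof -
  \<comment> \<open>\<open>frames\<close> asks for orthogonality in both orders,
    \<open>orth_compl\<close> in only one.\<close>
  have "hermitian_inner u (y $ i) = 0 \<longleftrightarrow> hermitian_inner (y $ i) u = 0" for i
    by (rule hermitian_inner_eq_0_commute)
  then show ?thesis
    using assms
    by (auto simp: frames_def orth_compl_def hermitian_inner_self_eq_1_iff split: if_splits)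
qed

text \<open>The cardinality bound leaves room for a further unit vector at each step, so that
  forgetting a member is surjective.\<close>

lemma connected_frames:
  fixes S :: "'n::finite set"
  assumes "card S \<le> CARD('k::finite)"
  shows "connected (frames S :: ((complex ^ 'k) ^ 'n) set)"
  using finite[of S] assms
proof (induction S rule: finite_induct)
  case empty
  have "frames {} = {0 :: (complex ^ 'k) ^ 'n}"
    by (auto simp: frames_def vec_eq_iff)
  then show ?case
    by simp
next
  case (insert a S)
  let ?X = "frames (insert a S) :: ((complex ^ 'k) ^ 'n) set"
  let ?Y = "frames S :: ((complex ^ 'k) ^ 'n) set"
  let ?f = "set_member a 0 :: (complex ^ 'k) ^ 'n \<Rightarrow> _"
  have card: "card S < CARD('k)"
    using insert by simp
  have lift: "?f (set_member a u y) = y" if "y \<in> ?Y" for u y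
    using that \<open>a \<notin> S\<close> by (auto simp: frames_def vec_eq_iff)
  have drop: "?f v \<in> ?Y" if "v \<in> ?X" for v
    using that \<open>a \<notin> S\<close> by (auto simp: frames_def)
  have cont: "continuous_on ?X ?f"
    by (intro continuous_intros)
  have surj: "?f ` ?X = ?Y"
  proof
    show "?f ` ?X \<subseteq> ?Y"
      using drop by blast
    show "?Y \<subseteq> ?f ` ?X"
    proof
      fix y :: "(complex ^ 'k) ^ 'n"
      assume y: "y \<in> ?Y"
      have "card (($) y ` S) < CARD('k)"
        using card card_image_le[OF \<open>finite S\<close>, of "($) y"] by linarith
      then obtain u where "u \<in> orth_compl (($) y ` S)" "norm u = 1"
        using orth_compl_unit_vector_exists \<open>finite S\<close> by (metis finite_imageI)
      then have "set_member a u y \<in> ?X"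
        using set_member_mem_frames_iff[OF y \<open>a \<notin> S\<close>] by simp
      then show "y \<in> ?f ` ?X"
        using lift[OF y, of u] by (metis imageI)
    qed
  qed
  have fibre: "connected (?X \<inter> ?f -` {y})" if y: "y \<in> ?Y" for y
  proof -
    let ?F = "orth_compl (($) y ` S) \<inter> sphere 0 1"
    have "?X \<inter> ?f -` {y} = (\<lambda>u. set_member a u y) ` ?F"
    proof
      show "?X \<inter> ?f -` {y} \<subseteq> (\<lambda>u. set_member a u y) ` ?F"
      proof
        fix v
        assume v: "v \<in> ?X \<inter> ?f -` {y}"
        then have "y = ?f v"
          by simp
        \<comment> \<open>A frame is recovered from its image under \<open>?f\<close> together with
          the forgotten member.\<close>
        then have "v = set_member a (v $ a) y"
          by (simp only: vec_eq_iff set_member_nth) simp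
        with v show "v \<in> (\<lambda>u. set_member a u y) ` ?F"
          using set_member_mem_frames_iff[OF y \<open>a \<notin> S\<close>] by (metis IntD1 imageI)
      qed
      show "(\<lambda>u. set_member a u y) ` ?F \<subseteq> ?X \<inter> ?f -` {y}"
        using set_member_mem_frames_iff[OF y \<open>a \<notin> S\<close>] lift[OF y] by blast
    qed
    \<comment> \<open>The fibre is a continuous image of the unit sphere of a complex
      subspace.\<close>
    moreover have "connected ?F"
      by (intro connected_subspace_Int_sphere aff_dim_complex_subspace_ne_1
          subspace_orth_compl mult_mem_orth_compl)
    ultimately show ?thesis
      by (auto intro!: connected_continuous_image continuous_intros)
  qed
  have "connected ?Y"
    using insert card by simp
  \<comment> \<open>Compactness of \<open>?X\<close> makes the continuous map \<open>?f\<close>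
    closed.\<close>
  have "closedin (top_of_set ?Y) (?f ` C)" if "closedin (top_of_set ?X) C" for C
    using that cont surj compact_frames by (rule Abstract_Topology_2.continuous_imp_closed_map)
  then have "connected (?X \<inter> ?f -` ?Y)"
    using connected_closed_monotone_preimage[OF cont surj _ fibre \<open>connected ?Y\<close> subset_refl] by blast
  moreover have "?X \<inter> ?f -` ?Y = ?X"
    using drop by blast
  ultimately show ?case
    by simp
qed

lemma St_orth_eq_frames: "St_orth = frames UNIV"
  by (simp add: St_orth_def frames_def)

lemma unitary_group_eq_St_orth: "unitary_group = (St_orth :: (complex ^ 'n ^ 'n) set)"
  \<comment> \<open>For square matrices this turns the first equation into the second, whose entries
    are the Hermitian products of the rows. Fixing the left factor as a
    \<open>conj_transpose\<close> keeps the rewriting from looping.\<close>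
  unfolding unitary_group_def matrix_left_right_inverse[of "conj_transpose _"]
  by (auto simp: St_orth_def hermitian_inner_def conj_transpose_def matrix_matrix_mult_def
      mat_def vec_eq_iff)

theorem theorem4p2:
  shows "(CARD('n::finite) \<le> CARD('k::finite) \<longrightarrow> connected (St_orth :: ((complex ^ 'k) ^ 'n) set))
    \<and> connected (unitary_group :: (complex ^ 'n ^ 'n) set)"
  \<comment> \<open>Both claims take \<open>S = UNIV\<close>; the unitary group is the case of equal
    dimensions, where the cardinality bound is an equality.\<close>
  unfolding unitary_group_eq_St_orth St_orth_eq_frames by (simp add: connected_frames)

end
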